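(* Let $\mathcal{L} \subseteq \mathbb{R}^m$ be a regular subspace, let $L = \mathcal{L} \cap \mathbb{Z}^m$, let $g \in \mathbb{R}^m$ with $g_i > 0$ for all $i$, and let $\pi_g : \mathbb{R}^m \to \mathcal{L}$ be the orthogonal projection onto $\mathcal{L}$ with respect to the inner product $(\cdot,\cdot)_g$. Then \[ \mathcal{V}(L) = \pi_g\big([-1/2,1/2]^m\big). \]
   Context: For $x \in \mathbb{R}^m$, $\mathrm{supp}\, x = \{i : x_i \neq 0\}$. For a linear subspace $\mathcal{L} \subseteq \mathbb{R}^m$, a nonzero $x \in \mathcal{L}$ is an elementary chain if its support is inclusion-wise minimal among supports of nonzero vectors of $\mathcal{L}$; an elementary chain with all entries in $\{-1,0,+1\}$ is a primitive chain. $\mathcal{L}$ is regular if every elementary chain is a scalar multiple of a primitive chain. $(x,y)_g = \sum_{i=1}^m g_i x_i y_i$. The Voronoi cell is $\mathcal{V}(L) = \{x \in \mathcal{L} : (x,x)_g \le (v-x,v-x)_g \text{ for all } v \in L\}$. *)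

theory Defs
  imports "HOL-Analysis.Analysis"
begin

definition vec_supp :: "real ^ 'm \<Rightarrow> 'm set" where
  "vec_supp x = {i. x $ i \<noteq> 0}"

definition elementary_chain :: "(real ^ 'm) set \<Rightarrow> real ^ 'm \<Rightarrow> bool" where
  "elementary_chain S x \<longleftrightarrow>
     x \<in> S \<and> x \<noteq> 0 \<and> (\<forall>y\<in>S. y \<noteq> 0 \<longrightarrow> \<not> vec_supp y \<subset> vec_supp x)"

definition primitive_chain :: "(real ^ 'm) set \<Rightarrow> real ^ 'm \<Rightarrow> bool" where
  "primitive_chain S x \<longleftrightarrow> elementary_chain S x \<and> (\<forall>i. x $ i \<in> {-1, 0, 1})"

definition regular_subspace :: "(real ^ 'm) set \<Rightarrow> bool" where
  "regular_subspace S \<longleftrightarrow>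
     subspace S \<and>
     (\<forall>x. elementary_chain S x \<longrightarrow> (\<exists>c p. primitive_chain S p \<and> x = c *\<^sub>R p))"

definition integer_vectors :: "(real ^ 'm) set" where
  "integer_vectors = {v. \<forall>i. v $ i \<in> \<int>}"

definition weighted_inner :: "real ^ 'm \<Rightarrow> real ^ 'm \<Rightarrow> real ^ 'm \<Rightarrow> real" where
  "weighted_inner g x y = (\<Sum>i\<in>UNIV. g $ i * x $ i * y $ i)"

text \<open>\<open>S\<close> is the ambient subspace in which the cell lives, \<open>L\<close> the set of lattice points.\<close>

definition voronoi_cell ::
  "real ^ 'm \<Rightarrow> (real ^ 'm) set \<Rightarrow> (real ^ 'm) set \<Rightarrow> (real ^ 'm) set" where
  "voronoi_cell g S L = {x \<in> S. \<forall>v\<in>L. weighted_inner g x x \<le> weighted_inner g (v - x) (v - x)}"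

text \<open>Well defined when \<open>S\<close> is a subspace and all entries of \<open>g\<close> are positive; see
  \<open>wproj_ex1\<close> below.\<close>

definition wproj :: "real ^ 'm \<Rightarrow> (real ^ 'm) set \<Rightarrow> real ^ 'm \<Rightarrow> real ^ 'm" where
  "wproj g S x = (THE p. p \<in> S \<and> (\<forall>y\<in>S. weighted_inner g (x - p) y = 0))"

lemma wproj_ex1:
  fixes g :: "real ^ 'm" and S :: "(real ^ 'm) set"
  assumes "subspace S" and g: "\<And>i. g $ i > 0"
  shows "\<exists>!p. p \<in> S \<and> (\<forall>y\<in>S. weighted_inner g (x - p) y = 0)"
proof -
  define s :: "real ^ 'm \<Rightarrow> real ^ 'm" where "s = (\<lambda>x. \<chi> i. sqrt (g $ i) * x $ i)"
  have lin: "linear s"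
    by (rule linearI) (auto simp: s_def vec_eq_iff algebra_simps)
  have w: "weighted_inner g a b = s a \<bullet> s b" for a b
  proof -
    have "g $ i * a $ i * b $ i = (sqrt (g $ i) * a $ i) * (sqrt (g $ i) * b $ i)" for i
    proof -
      have "sqrt (g $ i) * sqrt (g $ i) = g $ i"
        using g[of i] by simp
      then show ?thesis by (metis mult.assoc mult.left_commute)
    qed
    then show ?thesis unfolding weighted_inner_def inner_vec_def s_def
      by (simp only: vec_lambda_beta inner_real_def)
  qed
  have sub: "subspace (s ` S)"
    using lin assms(1) by (rule linear_subspace_image)
  then have span: "span (s ` S) = s ` S"
    by (simp add: span_eq_iff)
  obtain u z where u: "u \<in> span (s ` S)" and z: "\<And>w. w \<in> span (s ` S) \<Longrightarrow> orthogonal z w"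
    and x: "s x = u + z"
    using orthogonal_subspace_decomp_exists[of "s ` S" "s x"] by blast
  from u span obtain p where p: "p \<in> S" "u = s p" by auto
  have ex: "weighted_inner g (x - p) y = 0" if "y \<in> S" for y
    using z[of "s y"] that span x p by (simp add: w linear_diff[OF lin] orthogonal_def)
  show ?thesis
  proof (rule ex1I[of _ p])
    fix q assume q: "q \<in> S \<and> (\<forall>y\<in>S. weighted_inner g (x - q) y = 0)"
    have d: "p - q \<in> S" using p q assms(1) by (simp add: subspace_diff)
    have "weighted_inner g (x - q) (p - q) - weighted_inner g (x - p) (p - q) = weighted_inner g (p - q) (p - q)"
      by (simp add: w linear_diff[OF lin] algebra_simps)
    then have "s (p - q) = 0" using q ex[OF d] d by (simp add: w)
    moreover have "sqrt (g $ i) \<noteq> 0" for i using g[of i] by simp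
    ultimately show "q = p" by (auto simp: s_def vec_eq_iff)
  qed (use p ex in auto)
qed

end

theory Submission
  imports Defs
begin

text \<open>
  One inclusion only uses that every integer \<open>n\<close> satisfies \<open>n\<^sup>2 \<ge> \<bar>n\<bar>\<close>. For the other one, every
  \<open>a\<close> in a regular subspace is a nonnegative combination of primitive chains whose signs agree with
  those of \<open>a\<close>, so the Voronoi inequalities \<open>2 (p, x) \<le> (p, p) = \<Sum> g\<^sub>i \<bar>p\<^sub>i\<bar>\<close> of the primitive
  chains \<open>p\<close> add up to \<open>2 (a, x) \<le> \<Sum> g\<^sub>i \<bar>a\<^sub>i\<bar>\<close>. The right-hand side is twice the support function of
  the projected cube at \<open>a\<close>, hence no hyperplane separates \<open>x\<close> from the projected cube.
\<close>

section \<open>Weighted inner product and projection\<close>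

lemma weighted_inner_diff_left:
  "weighted_inner g (x - y) z = weighted_inner g x z - weighted_inner g y z"
  by (simp add: weighted_inner_def algebra_simps sum_subtractf)

lemma weighted_inner_add_left:
  "weighted_inner g (x + y) z = weighted_inner g x z + weighted_inner g y z"
  by (simp add: weighted_inner_def algebra_simps sum.distrib)

lemma weighted_inner_scaleR_left:
  "weighted_inner g (c *\<^sub>R x) z = c * weighted_inner g x z"
  by (simp add: weighted_inner_def algebra_simps sum_distrib_left)

lemma weighted_inner_commute: "weighted_inner g x y = weighted_inner g y x"
  by (simp add: weighted_inner_def mult.commute mult.left_commute)

lemma weighted_inner_diff_self:
  "weighted_inner g (v - x) (v - x) =
     weighted_inner g v v - 2 * weighted_inner g v x + weighted_inner g x x"
  using weighted_inner_commute[of g v x]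
  by (simp add: weighted_inner_diff_left weighted_inner_commute[of g _ "v - x"])

text \<open>Expanding the square cancels \<open>(x, x)_g\<close>, so each lattice point contributes
  a half-space, linear in \<open>x\<close>. Linearity is what allows the inequalities to be added up
  later.\<close>

lemma voronoi_cell_iff:
  "x \<in> voronoi_cell g S L \<longleftrightarrow>
     x \<in> S \<and> (\<forall>v\<in>L. 2 * weighted_inner g v x \<le> weighted_inner g v v)"
  by (auto simp: voronoi_cell_def weighted_inner_diff_self)

context
  fixes S :: "(real ^ 'm) set" and g :: "real ^ 'm"
  assumes S: "subspace S" and g: "\<And>i. g $ i > 0"
begin

lemma wproj_in: "wproj g S x \<in> S"
  and weighted_inner_wproj_ortho: "y \<in> S \<Longrightarrow> weighted_inner g (x - wproj g S x) y = 0"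
  using theI'[OF wproj_ex1[OF S g, of x]] unfolding wproj_def by auto

lemma weighted_inner_wproj: "y \<in> S \<Longrightarrow> weighted_inner g (wproj g S x) y = weighted_inner g x y"
  using weighted_inner_wproj_ortho[of y x] by (simp add: weighted_inner_diff_left)

lemma wproj_unique:
  assumes "p \<in> S" "\<And>y. y \<in> S \<Longrightarrow> weighted_inner g p y = weighted_inner g x y"
  shows "wproj g S x = p"
  unfolding wproj_def
  by (rule the1_equality[OF wproj_ex1[OF S g]]) (auto simp: assms weighted_inner_diff_left)

text \<open>Makes the projected cube convex and compact, as the separation argument
  requires.\<close>

lemma linear_wproj: "linear (wproj g S)"
proof (rule linearI)
  show "wproj g S (x + y) = wproj g S x + wproj g S y" for x y
    by (rule wproj_unique)
      (auto simp: weighted_inner_add_left weighted_inner_wproj wproj_in S subspace_add)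
  show "wproj g S (c *\<^sub>R x) = c *\<^sub>R wproj g S x" for c x
    by (rule wproj_unique)
      (auto simp: weighted_inner_scaleR_left weighted_inner_wproj wproj_in S subspace_scale)
qed

end

section \<open>Sign-conforming vectors and the support bound\<close>

definition conforms :: "real ^ 'm \<Rightarrow> real ^ 'm \<Rightarrow> bool" where
  "conforms y z \<longleftrightarrow> (\<forall>i. y $ i \<noteq> 0 \<longrightarrow> y $ i * z $ i > 0)"

text \<open>The scalar is the smallest ratio \<open>z\<^sub>i / y\<^sub>i\<close> over the coordinates where the signs agree.\<close>

lemma reduce_support:
  fixes y z :: "real ^ 'm"
  assumes supp: "vec_supp y \<subseteq> vec_supp z" and ex: "\<exists>i. y $ i * z $ i > 0"
  obtains t where "t > 0" "conforms (z - t *\<^sub>R y) z" "vec_supp (z - t *\<^sub>R y) \<subset> vec_supp z"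
proof -
  define I where "I = {i. y $ i * z $ i > 0}"
  define t where "t = Min ((\<lambda>i. z $ i / y $ i) ` I)"
  have "t \<in> (\<lambda>i. z $ i / y $ i) ` I"
    unfolding t_def using ex by (intro Min_in) (auto simp: I_def)
  then obtain k where k: "y $ k * z $ k > 0" "t = z $ k / y $ k"
    by (auto simp: I_def)
  have t: "t > 0"
    using k by (auto simp: zero_less_mult_iff zero_less_divide_iff)
  have tle: "t \<le> z $ i / y $ i" if "y $ i * z $ i > 0" for i
    unfolding t_def using that by (intro Min_le) (auto simp: I_def)
  \<comment> \<open>Where the signs agree, minimality of \<open>t\<close> prevents overshooting
    zero; elsewhere subtracting \<open>t *\<^sub>R y\<close> never moves an entry of
    \<open>z\<close> towards zero.\<close>
  have conf: "(z - t *\<^sub>R y) $ i * z $ i \<ge> 0" for i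
  proof (cases "y $ i * z $ i > 0")
    case True
    then have "z $ i \<noteq> 0" "y $ i \<noteq> 0" by auto
    have "t * (y $ i * z $ i) \<le> z $ i / y $ i * (y $ i * z $ i)"
      using tle[OF True] True by (intro mult_right_mono) auto
    then show ?thesis
      using \<open>y $ i \<noteq> 0\<close> by (simp add: algebra_simps)
  next
    case False
    then have "t * (y $ i * z $ i) \<le> 0"
      using t by (simp add: mult_nonneg_nonpos)
    moreover have "z $ i * z $ i \<ge> 0" by simp
    ultimately have "t * (y $ i * z $ i) \<le> z $ i * z $ i" by linarith
    then show ?thesis
      by (simp add: algebra_simps)
  qed
  have sub: "z $ i \<noteq> 0" if "(z - t *\<^sub>R y) $ i \<noteq> 0" for i
    using that supp by (auto simp: vec_supp_def)
  show ?thesis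
  proof (rule that[OF t])
    show "conforms (z - t *\<^sub>R y) z"
      unfolding conforms_def using conf sub by (metis less_le mult_eq_0_iff)
    \<comment> \<open>The coordinate attaining the minimal ratio is cancelled, so the inclusion of
      supports is strict.\<close>
    have "(z - t *\<^sub>R y) $ k = 0" "z $ k \<noteq> 0"
      using k by auto
    then show "vec_supp (z - t *\<^sub>R y) \<subset> vec_supp z"
      using sub by (fastforce simp: vec_supp_def)
  qed
qed

lemma conforms_trans: "conforms x y \<Longrightarrow> conforms y z \<Longrightarrow> conforms x z"
  unfolding conforms_def
  by (smt (verit, ccfv_threshold) mult_eq_0_iff zero_less_mult_iff)

lemma conforms_supp: "conforms y z \<Longrightarrow> vec_supp y \<subseteq> vec_supp z"
  by (auto simp: conforms_def vec_supp_def)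

text \<open>Take a nonzero conforming vector \<open>z\<close> of smallest support. A vector of
  \<open>S\<close> with properly smaller support could be used to cancel a coordinate of
  \<open>z\<close> without reversing a sign, contradicting minimality.\<close>

lemma exists_conforming_elementary_chain:
  fixes a :: "real ^ 'm"
  assumes S: "subspace S" and a: "a \<in> S" "a \<noteq> 0"
  obtains z where "elementary_chain S z" "conforms z a"
proof -
  define P where "P z \<longleftrightarrow> z \<in> S \<and> z \<noteq> 0 \<and> conforms z a" for z
  have "P a"
    using a by (auto simp: P_def conforms_def less_le)
  then obtain z where z: "P z" and min: "\<And>y. P y \<Longrightarrow> card (vec_supp z) \<le> card (vec_supp y)"
    using exists_least_iff[of "\<lambda>n. \<exists>z. P z \<and> card (vec_supp z) = n"] by (metis not_le)
  have "\<not> vec_supp y \<subset> vec_supp z" if y: "y \<in> S" "y \<noteq> 0" for y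
  proof
    assume sub: "vec_supp y \<subset> vec_supp z"
    from y obtain i where "y $ i \<noteq> 0" by (auto simp: vec_eq_iff)
    then have i: "y $ i * z $ i \<noteq> 0" using sub by (auto simp: vec_supp_def)
    \<comment> \<open>The sign is chosen so that \<open>w\<close> and \<open>z\<close> agree in sign
      at \<open>i\<close>, as \<open>reduce_support\<close> demands.\<close>
    define w where "w = (if y $ i * z $ i > 0 then y else - y)"
    have w: "w \<in> S" "vec_supp w = vec_supp y" "w $ i * z $ i > 0"
      using y S i by (auto simp: w_def subspace_neg vec_supp_def not_less order.order_iff_strict)
    then obtain t where t: "conforms (z - t *\<^sub>R w) z" "vec_supp (z - t *\<^sub>R w) \<subset> vec_supp z"
      using reduce_support[of w z] sub by (metis psubset_imp_subset)
    \<comment> \<open>Properness of the inclusion gives a coordinate of \<open>z\<close> that the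
      subtraction leaves alone, so the difference is nonzero.\<close>
    obtain j where "z $ j \<noteq> 0" "w $ j = 0"
      using sub w(2) by (auto simp: vec_supp_def)
    then have "(z - t *\<^sub>R w) $ j \<noteq> 0" by simp
    then have "z - t *\<^sub>R w \<noteq> 0" by (metis zero_index)
    then have "P (z - t *\<^sub>R w)"
      using z w t S by (auto simp: P_def subspace_diff subspace_scale intro: conforms_trans)
    then show False
      using min t(2) by (meson finite linorder_not_le psubset_card_mono)
  qed
  then have "elementary_chain S z"
    using z by (auto simp: elementary_chain_def P_def)
  then show thesis
    using that z by (auto simp: P_def)
qed

text \<open>Regularity rescales the conforming elementary chain to a primitive one. Conformity
  depends only on signs, so multiplying by \<open>sgn c\<close> restores it and keeps the entries in
  {-1, 0, 1}.\<close>

lemma exists_conforming_unit_vector: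
  fixes a :: "real ^ 'm"
  assumes S: "regular_subspace S" and a: "a \<in> S" "a \<noteq> 0"
  obtains p where "p \<in> S" "p \<noteq> 0" "\<And>i. p $ i \<in> {-1, 0, 1}" "conforms p a"
proof -
  have sub: "subspace S" using S by (simp add: regular_subspace_def)
  obtain z where z: "elementary_chain S z" "conforms z a"
    using exists_conforming_elementary_chain[OF sub a] .
  then obtain c p where p: "primitive_chain S p" "z = c *\<^sub>R p"
    using S unfolding regular_subspace_def by metis
  have "z \<noteq> 0" using z by (simp add: elementary_chain_def)
  then have c: "c \<noteq> 0" using p by auto
  have pS: "p \<in> S" "p \<noteq> 0" "\<And>i. p $ i \<in> {-1, 0, 1}"
    using p(1) by (auto simp: primitive_chain_def elementary_chain_def)
  show thesis
  proof (rule that[of "sgn c *\<^sub>R p"])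
    show "sgn c *\<^sub>R p \<in> S" "sgn c *\<^sub>R p \<noteq> 0"
      using pS c sub by (auto simp: subspace_scale sgn_if)
    show "(sgn c *\<^sub>R p) $ i \<in> {-1, 0, 1}" for i
      using pS(3)[of i] by (auto simp: sgn_if)
    show "conforms (sgn c *\<^sub>R p) a"
      using z(2) c unfolding p(2) conforms_def
      by (auto simp: sgn_if zero_less_mult_iff mult_less_0_iff)
  qed
qed

text \<open>Peel off a multiple \<open>t *\<^sub>R p\<close> of a conforming unit vector, which
  shrinks the support. Both sides of the bound are additive along this splitting, the right one
  because no signs cancel.\<close>

lemma voronoi_cell_support_bound:
  fixes S :: "(real ^ 'm) set"
  assumes S: "regular_subspace S"
    and x: "x \<in> voronoi_cell g S (S \<inter> integer_vectors)" and a: "a \<in> S"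
  shows "2 * weighted_inner g a x \<le> (\<Sum>i\<in>UNIV. g $ i * \<bar>a $ i\<bar>)"
  using a
proof (induction "card (vec_supp a)" arbitrary: a rule: less_induct)
  case less
  have sub: "subspace S" using S by (simp add: regular_subspace_def)
  show ?case
  proof (cases "a = 0")
    case True
    then show ?thesis by (simp add: weighted_inner_def)
  next
    case False
    then obtain p where p: "p \<in> S" "p \<noteq> 0" "\<And>i. p $ i \<in> {-1, 0, 1}" "conforms p a"
      using exists_conforming_unit_vector[OF S less.prems] by blast
    have "\<exists>i. p $ i * a $ i > 0"
      using p(2,4) by (auto simp: vec_eq_iff conforms_def)
    then obtain t where t: "t > 0" "conforms (a - t *\<^sub>R p) a" "vec_supp (a - t *\<^sub>R p) \<subset> vec_supp a"
      using reduce_support[OF conforms_supp[OF p(4)]] by blast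
    have IH: "2 * weighted_inner g (a - t *\<^sub>R p) x \<le> (\<Sum>i\<in>UNIV. g $ i * \<bar>(a - t *\<^sub>R p) $ i\<bar>)"
      using less.hyps[of "a - t *\<^sub>R p"] t(3) less.prems p(1) sub
      by (simp add: psubset_card_mono subspace_diff subspace_scale)
    have "p $ i \<in> \<int>" for i
      using p(3)[of i] by auto
    then have "2 * weighted_inner g p x \<le> weighted_inner g p p"
      using x p(1) by (auto simp: voronoi_cell_iff integer_vectors_def)
    \<comment> \<open>Entries in {-1, 0, 1} satisfy
      \<open>p $ i * p $ i = \<bar>p $ i\<bar>\<close>, which turns the quadratic bound into one
      that scales linearly with \<open>t\<close>.\<close>
    also have "\<dots> = (\<Sum>i\<in>UNIV. g $ i * \<bar>p $ i\<bar>)"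
      unfolding weighted_inner_def
    proof (rule sum.cong[OF refl])
      show "g $ i * p $ i * p $ i = g $ i * \<bar>p $ i\<bar>" for i
        using p(3)[of i] by auto
    qed
    finally have "t * (2 * weighted_inner g p x) \<le> t * (\<Sum>i\<in>UNIV. g $ i * \<bar>p $ i\<bar>)"
      using t(1) by simp
    moreover have "2 * weighted_inner g a x =
        2 * weighted_inner g (a - t *\<^sub>R p) x + t * (2 * weighted_inner g p x)"
      by (simp add: weighted_inner_diff_left weighted_inner_scaleR_left)
    \<comment> \<open>Both summands conform to \<open>a\<close>, so the triangle inequality is an
      equality in each coordinate.\<close>
    moreover have "\<bar>a $ i\<bar> = \<bar>(a - t *\<^sub>R p) $ i\<bar> + t * \<bar>p $ i\<bar>" for i
    proof (cases "a $ i > 0")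
      case True
      then have "p $ i \<ge> 0" "(a - t *\<^sub>R p) $ i \<ge> 0"
        using p(4) t(1,2) by (auto simp: conforms_def zero_less_mult_iff not_le dest!: spec[of _ i])
      then show ?thesis using True by simp
    next
      case False
      then have "p $ i \<le> 0" "(a - t *\<^sub>R p) $ i \<le> 0"
        using p(4) t(1,2) by (auto simp: conforms_def zero_less_mult_iff not_le dest!: spec[of _ i])
      then show ?thesis using False by simp
    qed
    then have "(\<Sum>i\<in>UNIV. g $ i * \<bar>a $ i\<bar>) =
        (\<Sum>i\<in>UNIV. g $ i * \<bar>(a - t *\<^sub>R p) $ i\<bar>) + t * (\<Sum>i\<in>UNIV. g $ i * \<bar>p $ i\<bar>)"
      by (simp add: sum_distrib_left flip: sum.distrib) (simp add: algebra_simps)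
    ultimately show ?thesis
      using IH by linarith
  qed
qed

section \<open>The two inclusions\<close>

lemma wproj_cube_subset_voronoi_cell:
  fixes S :: "(real ^ 'm) set"
  assumes S: "subspace S" and g: "\<And>i. g $ i > 0"
  shows "wproj g S ` cbox (\<chi> i. - 1 / 2) (\<chi> i. 1 / 2) \<subseteq> voronoi_cell g S (S \<inter> integer_vectors)"
proof clarify
  fix y :: "real ^ 'm"
  assume "y \<in> cbox (\<chi> i. - 1 / 2) (\<chi> i. 1 / 2)"
  then have y: "\<bar>2 * y $ i\<bar> \<le> 1" for i
    by (auto simp: mem_box_cart abs_le_iff dest!: spec[of _ i])
  have "2 * weighted_inner g v (wproj g S y) \<le> weighted_inner g v v"
    if v: "v \<in> S" "v \<in> integer_vectors" for v
  proof -
    \<comment> \<open>Pairing with \<open>v\<close> in \<open>S\<close> removes the projection and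
      leaves a coordinatewise estimate.\<close>
    have "2 * weighted_inner g v (wproj g S y) = 2 * weighted_inner g v y"
      using weighted_inner_wproj[OF S g v(1), of y] by (simp add: weighted_inner_commute)
    also have "\<dots> = (\<Sum>i\<in>UNIV. g $ i * (v $ i * (2 * y $ i)))"
      by (simp add: weighted_inner_def sum_distrib_left algebra_simps)
    also have "\<dots> \<le> (\<Sum>i\<in>UNIV. g $ i * (v $ i * v $ i))"
    proof (rule sum_mono, rule mult_left_mono)
      fix i
      have "v $ i \<in> \<int>" using v by (simp add: integer_vectors_def)
      then have "v $ i \<noteq> 0 \<Longrightarrow> \<bar>2 * y $ i\<bar> \<le> \<bar>v $ i\<bar>"
        using Ints_nonzero_abs_ge1 y[of i] order_trans by blast
      then have "\<bar>v $ i\<bar> * \<bar>2 * y $ i\<bar> \<le> \<bar>v $ i\<bar> * \<bar>v $ i\<bar>"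
        by (metis abs_ge_zero abs_zero mult_left_mono mult_zero_left order_refl)
      then show "v $ i * (2 * y $ i) \<le> v $ i * v $ i"
        by (metis abs_le_D1 abs_mult abs_mult_self_eq)
    qed (use g in \<open>simp add: less_imp_le\<close>)
    also have "\<dots> = weighted_inner g v v"
      by (simp add: weighted_inner_def mult.assoc)
    finally show ?thesis .
  qed
  then show "wproj g S y \<in> voronoi_cell g S (S \<inter> integer_vectors)"
    by (auto simp: voronoi_cell_iff wproj_in[OF S g])
qed

lemma voronoi_cell_subset_wproj_cube:
  fixes S :: "(real ^ 'm) set"
  assumes S: "regular_subspace S" and g: "\<And>i. g $ i > 0"
  shows "voronoi_cell g S (S \<inter> integer_vectors) \<subseteq> wproj g S ` cbox (\<chi> i. - 1 / 2) (\<chi> i. 1 / 2)"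
    (is "?V \<subseteq> ?P")
proof (rule subsetI, rule ccontr)
  have sub: "subspace S" using S by (simp add: regular_subspace_def)
  note lin = linear_wproj[OF sub g]
  fix x assume x: "x \<in> ?V" and "x \<notin> ?P"
  have "convex ?P"
    using lin by (intro convex_linear_image) auto
  moreover have "closed ?P"
    using lin by (intro compact_imp_closed compact_continuous_image linear_continuous_on)
      (auto simp: linear_conv_bounded_linear)
  ultimately obtain a b where ab: "a \<bullet> x < b" "\<And>p. p \<in> ?P \<Longrightarrow> a \<bullet> p > b"
    using separating_hyperplane_closed_point[of ?P x] \<open>x \<notin> ?P\<close> by blast
  \<comment> \<open>Dividing by \<open>g\<close> represents the functional
    \<open>- (a \<bullet> _)\<close> in the weighted inner product; projecting keeps its values on
    \<open>S\<close> and makes the support bound applicable.\<close>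
  define h where "h = wproj g S (\<chi> i. - a $ i / g $ i)"
  have hS: "h \<in> S" by (simp add: h_def wproj_in[OF sub g])
  have xS: "x \<in> S" using x by (simp add: voronoi_cell_def)
  have h: "a \<bullet> p = - weighted_inner g h p" if "p \<in> S" for p
  proof -
    have "weighted_inner g h p = weighted_inner g (\<chi> i. - a $ i / g $ i) p"
      unfolding h_def by (rule weighted_inner_wproj[OF sub g that])
    also have "\<dots> = - (a \<bullet> p)"
      using g by (simp add: weighted_inner_def inner_vec_def less_imp_neq[THEN not_sym] sum_negf)
    finally show ?thesis by simp
  qed
  \<comment> \<open>A point of the cube maximizing \<open>weighted_inner g h\<close>, with maximum
    half the right-hand side of the support bound.\<close>
  define y :: "real ^ 'm" where "y = (\<chi> i. sgn (h $ i) / 2)"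
  have "y \<in> cbox (\<chi> i. - 1 / 2) (\<chi> i. 1 / 2)"
    by (auto simp: y_def mem_box_cart sgn_if)
  then have "b < a \<bullet> wproj g S y"
    by (intro ab(2) imageI)
  also have "\<dots> = - weighted_inner g h y"
    using weighted_inner_wproj[OF sub g hS, of y]
    by (simp add: h wproj_in[OF sub g] weighted_inner_commute)
  also have "weighted_inner g h y = (\<Sum>i\<in>UNIV. g $ i * \<bar>h $ i\<bar>) / 2"
    by (simp add: weighted_inner_def y_def sum_divide_distrib abs_sgn mult.assoc)
  finally show False
    using voronoi_cell_support_bound[OF S x hS] ab(1) h[OF xS] by linarith
qed

theorem theorem2p3:
  fixes S :: "(real ^ 'm) set" and g :: "real ^ 'm"
  assumes "regular_subspace S"
    and "\<And>i. g $ i > 0"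
  shows "voronoi_cell g S (S \<inter> integer_vectors) =
         wproj g S ` cbox (\<chi> i. - 1 / 2) (\<chi> i. 1 / 2)"
  using assms voronoi_cell_subset_wproj_cube wproj_cube_subset_voronoi_cell
  unfolding regular_subspace_def by (metis subset_antisym)

end
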